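(* Let $\alpha\in(0,1)$, let $\Phi(c_{\alpha/2})=1-\alpha/2$, and let $\rho_0\in[0,1]$. Suppose $(T_1,\dots,T_C)$ is jointly normal with zero means, unit variances and covariance matrix $\Sigma_{ij}=\rho_{ij}$ such that $0\le\rho_{ij}\le\rho_0$ for all $i\ne j$. Let $R_i=\{|T_i|>c_{\alpha/2}\}$ and $E=\sum_{i=1}^C\mathbf 1_{R_i}$. Then $$\operatorname{Var}(E)\le C\alpha(1-\alpha)+C(C-1)\,R(\rho_0,c_{\alpha/2}),$$ where $$R(\rho,c_{\alpha/2})=2\left(\Phi_\rho(c_{\alpha/2},c_{\alpha/2})+\Phi_{-\rho}(c_{\alpha/2},c_{\alpha/2})-2\Phi(c_{\alpha/2})^2\right),$$ which equals $\mathbb P(|U|>c_{\alpha/2},|V|>c_{\alpha/2})-\alpha^2$ for $(U,V)$ bivariate normal with zero means, unit variances and correlation $\rho$.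
   Context: $\Phi$ is the standard normal CDF, and $\Phi_\rho(x,y)$ is the CDF of the bivariate normal law with zero means, unit variances and correlation $\rho$ (degenerate when $|\rho|=1$). $E$ is the Type I error count under the global null. *)

theory Defs
  imports "HOL-Probability.Probability"
begin

text \<open>The normal law with mean \<open>\<mu>\<close> and standard deviation \<open>\<sigma> \<ge> 0\<close>; \<open>\<sigma> = 0\<close> gives a point mass.\<close>

definition normal_law :: "real \<Rightarrow> real \<Rightarrow> real measure" where
  "normal_law \<mu> \<sigma> = (if \<sigma> = 0 then return borel \<mu> else density lborel (normal_density \<mu> \<sigma>))"

text \<open>Joint normality in the usual sense that every linear combination is normal. Singular
  covariance matrices are included.\<close>

definition jointly_normal :: "'a measure \<Rightarrow> 'i set \<Rightarrow> ('i \<Rightarrow> 'a \<Rightarrow> real) \<Rightarrow> bool" where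
  "jointly_normal M I X \<longleftrightarrow>
     (\<forall>i\<in>I. X i \<in> borel_measurable M) \<and>
     (\<forall>a :: 'i \<Rightarrow> real. \<exists>\<mu> \<sigma>. \<sigma> \<ge> 0 \<and>
        distr M borel (\<lambda>\<omega>. \<Sum>i\<in>I. a i * X i \<omega>) = normal_law \<mu> \<sigma>)"

definition covariance :: "'a measure \<Rightarrow> ('a \<Rightarrow> real) \<Rightarrow> ('a \<Rightarrow> real) \<Rightarrow> real" where
  "covariance M X Y =
     (\<integral>\<omega>. (X \<omega> - (\<integral>\<omega>. X \<omega> \<partial>M)) * (Y \<omega> - (\<integral>\<omega>. Y \<omega> \<partial>M)) \<partial>M)"

definition std_normal_cdf :: "real \<Rightarrow> real" where
  "std_normal_cdf x = cdf std_normal_distribution x"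

text \<open>The bivariate normal law with zero means, unit variances and correlation \<open>\<rho> \<in> {-1..1}\<close>,
  as the law of \<open>(Z, \<rho> Z + sqrt (1 - \<rho>\<^sup>2) W)\<close> for independent standard normal \<open>Z\<close>, \<open>W\<close>.
  This form also covers the degenerate cases \<open>\<rho> = 1\<close> and \<open>\<rho> = -1\<close>. The facts \<open>bivariate_normal_law_*\<close>
  below confirm joint normality and the moments.\<close>

definition bivariate_normal_law :: "real \<Rightarrow> (real \<times> real) measure" where
  "bivariate_normal_law \<rho> =
     distr (std_normal_distribution \<Otimes>\<^sub>M std_normal_distribution) borel
       (\<lambda>(z, w). (z, \<rho> * z + sqrt (1 - \<rho>\<^sup>2) * w))"

definition bivariate_normal_cdf :: "real \<Rightarrow> real \<Rightarrow> real \<Rightarrow> real" where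
  "bivariate_normal_cdf \<rho> x y = measure (bivariate_normal_law \<rho>) ({..x} \<times> {..y})"

definition rejection_event :: "'a measure \<Rightarrow> (nat \<Rightarrow> 'a \<Rightarrow> real) \<Rightarrow> real \<Rightarrow> nat \<Rightarrow> 'a set" where
  "rejection_event M T c i = {\<omega> \<in> space M. \<bar>T i \<omega>\<bar> > c}"

definition error_count :: "'a measure \<Rightarrow> (nat \<Rightarrow> 'a \<Rightarrow> real) \<Rightarrow> real \<Rightarrow> nat \<Rightarrow> 'a \<Rightarrow> real" where
  "error_count M T c C \<omega> = (\<Sum>i=1..C. indicator (rejection_event M T c i) \<omega>)"

definition R_fun :: "real \<Rightarrow> real \<Rightarrow> real" where
  "R_fun \<rho> c = 2 * (bivariate_normal_cdf \<rho> c c + bivariate_normal_cdf (- \<rho>) c c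
                      - 2 * (std_normal_cdf c)\<^sup>2)"

context
begin

interpretation N: prob_space std_normal_distribution
  by (rule prob_space_normal_density) simp

private abbreviation (input) "NN \<equiv> std_normal_distribution \<Otimes>\<^sub>M std_normal_distribution"

interpretation NN: pair_prob_space std_normal_distribution std_normal_distribution ..

private lemma fst_snd_std_normal:
  "distributed NN lborel fst std_normal_density"
  "distributed NN lborel snd std_normal_density"
proof -
  have "distr NN lborel fst = distr NN std_normal_distribution fst"
    by (rule distr_cong) auto
  then show "distributed NN lborel fst std_normal_density"
    by (simp add: distributed_def N.distr_pair_fst)
  have "distr NN lborel snd = distr (distr NN NN (\<lambda>(x, y). (y, x))) lborel fst"
    by (subst distr_distr) (auto simp: o_def case_prod_beta intro!: distr_cong)
  also have "\<dots> = distr NN std_normal_distribution fst"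
    by (subst NN.distr_pair_swap[symmetric]) (auto intro!: distr_cong)
  finally show "distributed NN lborel snd std_normal_density"
    by (simp add: distributed_def N.distr_pair_fst)
qed

private lemma indep_fst_snd: "NN.indep_var borel fst borel snd"
proof -
  have 1: "distr NN borel fst = distr NN lborel fst" "distr NN borel snd = distr NN lborel snd"
    by (auto intro!: distr_cong)
  have 2: "distr NN (borel \<Otimes>\<^sub>M borel) (\<lambda>x. (fst x, snd x)) = NN"
    by (simp, rule distr_id2) (auto intro!: sets_pair_measure_cong)
  show ?thesis
    using fst_snd_std_normal
    by (simp add: NN.indep_var_distribution_eq 1 distributed_def 2[simplified])
qed

private lemma linear_comb_normal_law:
  "distr NN borel (\<lambda>p. a * fst p + b * snd p) = normal_law 0 (sqrt (a\<^sup>2 + b\<^sup>2))"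
proof -
  have s: "distr NN borel (\<lambda>p. c * X p) = density lborel (normal_density 0 \<bar>c\<bar>) \<and>
           distributed NN lborel (\<lambda>p. c * X p) (normal_density 0 \<bar>c\<bar>)"
    if "distributed NN lborel X std_normal_density" "c \<noteq> 0" for X c
  proof -
    have "distributed NN lborel (\<lambda>p. 0 + c * X p) (normal_density (0 + c * 0) (\<bar>c\<bar> * 1))"
      by (rule NN.normal_density_affine) (use that in auto)
    moreover have "distr NN borel (\<lambda>p. c * X p) = distr NN lborel (\<lambda>p. c * X p)"
      by (rule distr_cong) auto
    ultimately show ?thesis
      by (simp add: distributed_def)
  qed
  consider "a = 0" "b = 0" | "a \<noteq> 0" "b = 0" | "a = 0" "b \<noteq> 0" | "a \<noteq> 0" "b \<noteq> 0" by blast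
  then show ?thesis
  proof cases
    case 1
    then show ?thesis by (simp add: normal_law_def NN.distr_const)
  next
    case 2
    then show ?thesis using s[OF fst_snd_std_normal(1), of a] by (simp add: normal_law_def)
  next
    case 3
    then show ?thesis using s[OF fst_snd_std_normal(2), of b] by (simp add: normal_law_def)
  next
    case 4
    have i: "NN.indep_var borel (\<lambda>p. a * fst p) borel (\<lambda>p. b * snd p)"
      using NN.indep_var_compose[OF indep_fst_snd, of "\<lambda>x. a * x" borel "\<lambda>x. b * x" borel]
      by (simp add: o_def)
    have "distributed NN lborel (\<lambda>p. a * fst p + b * snd p)
            (normal_density (0 + 0) (sqrt (\<bar>a\<bar>\<^sup>2 + \<bar>b\<bar>\<^sup>2)))"
      by (rule NN.add_indep_normal[OF i]) (use 4 s fst_snd_std_normal in auto)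
    moreover have "distr NN borel (\<lambda>p. a * fst p + b * snd p)
        = distr NN lborel (\<lambda>p. a * fst p + b * snd p)"
      by (rule distr_cong) auto
    ultimately show ?thesis
      using 4 by (simp add: normal_law_def distributed_def add_nonneg_eq_0_iff)
  qed
qed

private lemma bivariate_map_measurable [measurable]:
  "(\<lambda>(z, w). (z, \<rho> * z + sqrt (1 - \<rho>\<^sup>2) * w)) \<in> NN \<rightarrow>\<^sub>M (borel :: (real \<times> real) measure)"
  by (simp flip: borel_prod)

lemma prob_space_bivariate_normal_law: "prob_space (bivariate_normal_law \<rho>)"
  unfolding bivariate_normal_law_def by (rule NN.prob_space_distr) measurable

lemma bivariate_normal_law_jointly_normal:
  "jointly_normal (bivariate_normal_law \<rho>) UNIV (case_bool fst snd)"
proof -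
  have "\<exists>\<mu> \<sigma>. \<sigma> \<ge> 0 \<and> distr (bivariate_normal_law \<rho>) borel
          (\<lambda>\<omega>. \<Sum>i\<in>UNIV. a i * (case i of True \<Rightarrow> fst | False \<Rightarrow> snd) \<omega>) = normal_law \<mu> \<sigma>"
    for a :: "bool \<Rightarrow> real"
  proof -
    have "distr (bivariate_normal_law \<rho>) borel
            (\<lambda>\<omega>. \<Sum>i\<in>UNIV. a i * (case i of True \<Rightarrow> fst | False \<Rightarrow> snd) \<omega>)
        = distr NN borel (\<lambda>p. (a True + a False * \<rho>) * fst p + (a False * sqrt (1 - \<rho>\<^sup>2)) * snd p)"
      unfolding bivariate_normal_law_def
      by (subst distr_distr)
         (auto simp: UNIV_bool o_def case_prod_beta algebra_simps intro!: distr_cong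
               simp flip: borel_prod)
    also note linear_comb_normal_law
    finally show ?thesis
      by (intro exI conjI) auto
  qed
  then show ?thesis
    by (auto simp: jointly_normal_def bivariate_normal_law_def split: bool.split simp flip: borel_prod)
qed

lemma bivariate_normal_law_moments:
  assumes "-1 \<le> \<rho>" "\<rho> \<le> 1"
  defines "L \<equiv> bivariate_normal_law \<rho>"
  shows "prob_space.expectation L fst = 0" "prob_space.expectation L snd = 0"
    and "prob_space.variance L fst = 1" "prob_space.variance L snd = 1"
    and "covariance L fst snd = \<rho>"
proof -
  define s where "s = sqrt (1 - \<rho>\<^sup>2)"
  have s2: "s\<^sup>2 = 1 - \<rho>\<^sup>2"
    using assms(1,2) by (simp add: s_def abs_le_iff abs_square_le_1)
  have int: "integral\<^sup>L L f = (\<integral>p. f (fst p, \<rho> * fst p + s * snd p) \<partial>NN)"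
    if "f \<in> borel_measurable borel" for f :: "real \<times> real \<Rightarrow> real"
    unfolding L_def bivariate_normal_law_def
    by (subst integral_distr) (use that in \<open>auto simp: case_prod_beta s_def\<close>)
  have mom: "has_bochner_integral NN X 0" "has_bochner_integral NN (\<lambda>p. (X p)\<^sup>2) 1"
    if X: "distributed NN lborel X std_normal_density" for X
  proof -
    have "integrable NN X"
      using integrable_std_normal_moment[of 1] distributed_integrable[OF X, of "\<lambda>x. x"] by simp
    then show "has_bochner_integral NN X 0"
      using NN.standard_normal_distributed_expectation[OF X] by (simp add: has_bochner_integral_iff)
    have "integrable NN (\<lambda>p. (X p)\<^sup>2)"
      using integrable_std_normal_moment[of 2] distributed_integrable[OF X, of "\<lambda>x. x\<^sup>2"] by simp
    then show "has_bochner_integral NN (\<lambda>p. (X p)\<^sup>2) 1"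
      using NN.standard_normal_distributed_variance[OF X]
        NN.standard_normal_distributed_expectation[OF X] by (simp add: has_bochner_integral_iff)
  qed
  note m = mom[OF fst_snd_std_normal(1)] mom[OF fst_snd_std_normal(2)]
  have cross: "has_bochner_integral NN (\<lambda>p. fst p * snd p) 0"
    using NN.indep_var_lebesgue_integral[OF indep_fst_snd] NN.indep_var_integrable[OF indep_fst_snd] m
    by (simp add: has_bochner_integral_iff)
  show e: "prob_space.expectation L fst = 0" "prob_space.expectation L snd = 0"
    using m by (simp_all add: int has_bochner_integral_iff flip: borel_prod)
  show "prob_space.variance L fst = 1"
    using m by (simp add: e int has_bochner_integral_iff flip: borel_prod)
  have "prob_space.variance L snd
      = (\<integral>p. \<rho>\<^sup>2 * (fst p)\<^sup>2 + s\<^sup>2 * (snd p)\<^sup>2 + 2 * \<rho> * s * (fst p * snd p) \<partial>NN)"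
    by (simp add: e int power2_sum power_mult_distrib algebra_simps flip: borel_prod)
  also have "\<dots> = 1"
    using m cross s2 by (simp add: has_bochner_integral_iff)
  finally show "prob_space.variance L snd = 1" .
  have "covariance L fst snd = (\<integral>p. \<rho> * (fst p)\<^sup>2 + s * (fst p * snd p) \<partial>NN)"
    by (simp add: covariance_def e int power2_eq_square algebra_simps flip: borel_prod)
  also have "\<dots> = \<rho>"
    using m cross by (simp add: has_bochner_integral_iff)
  finally show "covariance L fst snd = \<rho>" .
qed

end

end

theory Submission
  imports Defs
begin

text \<open>The variance splits into the terms \<open>\<alpha>(1 - \<alpha>)\<close> and the covariances of the rejection indicators,
  and the joint law of each pair of statistics is the bivariate normal law with its correlation
  (a Cramer--Wold argument). So it suffices that \<open>\<P>(U \<in> A, V \<in> A)\<close> is nondecreasing in the correlation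
  \<open>r \<in> [0, 1]\<close>. With the Ornstein--Uhlenbeck kernel \<open>Q r f z = \<E> f (r z + sqrt (1 - r\<^sup>2) W)\<close>, which is a
  symmetric multiplicative semigroup on \<open>L\<^sup>2\<close> of the standard normal law, this probability is
  \<open>\<langle>1\<^sub>A, Q r 1\<^sub>A\<rangle> = \<parallel>Q (sqrt r) 1\<^sub>A\<parallel>\<^sup>2\<close>; for \<open>r \<le> s\<close>, \<open>Q (sqrt r) = Q (sqrt (r / s)) Q (sqrt s)\<close> and
  each \<open>Q r\<close> is a contraction.\<close>

section \<open>Uniqueness of joint laws via characteristic functions\<close>

text \<open>Dividing the weights by their total mass turns \<open>density M w\<close> and
  \<open>density N w'\<close> into probability measures. The hypothesis then says that the images
  under \<open>X\<close> and \<open>X'\<close> have the same characteristic function, and Levy's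
  uniqueness theorem applies.\<close>

lemma weighted_law_unique_nonneg:
  fixes X :: "'a \<Rightarrow> real" and X' :: "'b \<Rightarrow> real" and w w'
  assumes "prob_space M" "prob_space N"
    and [measurable]: "X \<in> borel_measurable M" "X' \<in> borel_measurable N"
      "w \<in> borel_measurable M" "w' \<in> borel_measurable N"
    and w: "\<And>x. 0 \<le> w x" "\<And>x. w x \<le> B" and w': "\<And>x. 0 \<le> w' x" "\<And>x. w' x \<le> B"
    and char: "\<And>t. (CLINT x|M. iexp (t * X x) * of_real (w x)) = (CLINT x|N. iexp (t * X' x) *
      of_real (w' x))"
    and [measurable]: "A \<in> sets borel"
  shows "(\<integral>x. indicator A (X x) * w x \<partial>M) = (\<integral>x. indicator A (X' x) * w' x \<partial>N)"
proof -
  interpret M: prob_space M by fact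
  interpret N: prob_space N by fact
  have iM: "integrable M w" and iN: "integrable N w'"
    using w w' by (auto intro!: M.integrable_const_bound[of _ B] N.integrable_const_bound[of _ B])
  define m where "m = (\<integral>x. w x \<partial>M)"
  \<comment> \<open>At \<open>t = 0\<close> the hypothesis compares the total masses, so one
    constant \<open>m\<close> normalizes both sides.\<close>
  have "complex_of_real (\<integral>x. w x \<partial>M) = complex_of_real (\<integral>x. w' x \<partial>N)"
    using char[of 0] by simp
  then have m': "m = (\<integral>x. w' x \<partial>N)"
    unfolding m_def by (simp only: of_real_eq_iff)
  have "m \<ge> 0" unfolding m_def using w by (intro integral_nonneg_AE) auto
  show ?thesis
  proof (cases "m = 0")
    case True
    \<comment> \<open>With total mass zero there is nothing to normalize, but the weights vanish
      almost everywhere.\<close>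
    have "AE x in M. w x = 0" "AE x in N. w' x = 0"
      using True m_def w iM apply (simp add: integral_nonneg_eq_0_iff_AE)
      using True m' w' iN by (simp add: integral_nonneg_eq_0_iff_AE)
    then have "(\<integral>x. indicator A (X x) * w x \<partial>M) = 0" "(\<integral>x. indicator A (X' x) * w' x \<partial>N) = 0"
      by (auto intro!: integral_eq_zero_AE elim!: eventually_mono)
    then show ?thesis by simp
  next
    case False
    with \<open>m \<ge> 0\<close> have "m > 0" by simp
    \<comment> \<open>Stated over an arbitrary space \<open>K\<close>, so that it can be
      instantiated with both sides.\<close>
    have *: "real_distribution (distr (density K (\<lambda>x. ennreal (v x / m))) borel Y)
        \<and> char (distr (density K (\<lambda>x. ennreal (v x / m))) borel Y)
            = (\<lambda>t. (CLINT x|K. iexp (t * Y x) * of_real (v x)) / of_real m)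
        \<and> measure (distr (density K (\<lambda>x. ennreal (v x / m))) borel Y) A
            = (\<integral>x. indicator A (Y x) * v x \<partial>K) / m"
      if "prob_space K" and [measurable]: "Y \<in> borel_measurable K" "v \<in> borel_measurable K"
        and v: "\<And>x. 0 \<le> v x" and i: "integrable K v" and m: "(\<integral>x. v x \<partial>K) = m"
      for K :: "'c measure" and Y v
    proof -
      have "emeasure (density K (\<lambda>x. ennreal (v x / m))) (space K) = (\<integral>\<^sup>+x. ennreal (v x / m) \<partial>K)"
        by (subst emeasure_density) (auto intro!: nn_integral_cong)
      also have "\<dots> = ennreal (\<integral>x. v x / m \<partial>K)"
        using i v \<open>m > 0\<close> by (intro nn_integral_eq_integral) auto
      also have "\<dots> = 1" using m \<open>m > 0\<close> by simp
      finally interpret D: prob_space "density K (\<lambda>x. ennreal (v x / m))"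
        by (intro prob_spaceI) simp
      have r: "real_distribution (distr (density K (\<lambda>x. ennreal (v x / m))) borel Y)"
        by (rule D.real_distribution_distr) simp
      have "char (distr (density K (\<lambda>x. ennreal (v x / m))) borel Y) t
            = (CLINT x|K. iexp (t * Y x) * of_real (v x)) / of_real m" for t
        unfolding char_def using v \<open>m > 0\<close>
        by (subst integral_distr, simp, simp, subst integral_density)
           (auto simp: scaleR_conv_of_real mult.commute simp flip: integral_divide_zero)
      moreover have "measure (distr (density K (\<lambda>x. ennreal (v x / m))) borel Y) A
            = (\<integral>x. indicator A (Y x) * v x \<partial>K) / m"
      proof -
        have "measure (distr (density K (\<lambda>x. ennreal (v x / m))) borel Y) A
          = (\<integral>y. indicator A y \<partial>distr (density K (\<lambda>x. ennreal (v x / m))) borel Y)"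
          by simp
        also have "\<dots> = (\<integral>x. indicator A (Y x) * v x \<partial>K) / m"
          using v \<open>m > 0\<close> by (subst integral_distr, simp, simp, subst integral_density)
             (auto simp: mult.commute simp flip: integral_divide_zero)
        finally show ?thesis .
      qed
      ultimately show ?thesis using r by auto
    qed
    note 1 = *[OF \<open>prob_space M\<close> _ _ w(1) iM m_def[symmetric], of X]
    note 2 = *[OF \<open>prob_space N\<close> _ _ w'(1) iN m'[symmetric], of X']
    have "distr (density M (\<lambda>x. ennreal (w x / m))) borel X = distr (density N (\<lambda>x. ennreal (w' x
      / m))) borel X'"
      using 1 2 char by (intro Levy_uniqueness) simp_all
    then show ?thesis
      using 1 2 \<open>m > 0\<close> by simp
  qed
qed

text \<open>A signed weight bounded by 1 becomes nonnegative after adding 1. The previous lemma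
  applies to \<open>1 + w\<close> and, by \<open>char0\<close>, to the constant weight 1; the claim
  is the difference.\<close>

lemma weighted_law_unique:
  fixes X :: "'a \<Rightarrow> real" and X' :: "'b \<Rightarrow> real" and w w' :: "_ \<Rightarrow> real"
  assumes "prob_space M" "prob_space N"
    and [measurable]: "X \<in> borel_measurable M" "X' \<in> borel_measurable N"
      "w \<in> borel_measurable M" "w' \<in> borel_measurable N"
    and w: "\<And>x. \<bar>w x\<bar> \<le> 1" and w': "\<And>x. \<bar>w' x\<bar> \<le> 1"
    and char0: "\<And>t. (CLINT x|M. iexp (t * X x)) = (CLINT x|N. iexp (t * X' x))"
    and char: "\<And>t. (CLINT x|M. iexp (t * X x) * of_real (w x)) = (CLINT x|N. iexp (t * X' x) *
      of_real (w' x))"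
    and [measurable]: "A \<in> sets borel"
  shows "(\<integral>x. indicator A (X x) * w x \<partial>M) = (\<integral>x. indicator A (X' x) * w' x \<partial>N)"
proof -
  interpret M: prob_space M by fact
  interpret N: prob_space N by fact
  have c: "integrable M (\<lambda>x. iexp (t * X x))" "integrable M (\<lambda>x. iexp (t * X x) * of_real (w x))"
    "integrable N (\<lambda>x. iexp (t * X' x))" "integrable N (\<lambda>x. iexp (t * X' x) * of_real (w' x))" for t
    using w w' by (auto intro!: M.integrable_const_bound[of _ 1] N.integrable_const_bound[of _ 1]
      simp: norm_mult simp del: of_real_mult)
  have i: "integrable M (\<lambda>x. indicat_real A (X x))" "integrable M (\<lambda>x. indicator A (X x) * w x)"
    "integrable N (\<lambda>x. indicat_real A (X' x))" "integrable N (\<lambda>x. indicator A (X' x) * w' x)"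
    using w w' by (auto intro!: M.integrable_const_bound[of _ 1] N.integrable_const_bound[of _ 1]
      split: split_indicator)
  have b: "0 \<le> 1 + w x" "1 + w x \<le> 2" for x using w[of x] by linarith+
  have b': "0 \<le> 1 + w' x" "1 + w' x \<le> 2" for x using w'[of x] by linarith+
  have "(\<integral>x. indicator A (X x) * (1 + w x) \<partial>M) = (\<integral>x. indicator A (X' x) * (1 + w' x) \<partial>N)"
    by (rule weighted_law_unique_nonneg[OF assms(1-4), where B=2])
       (use b b' c char0 char in \<open>simp_all add: distrib_left del: of_real_mult\<close>)
  moreover have "(\<integral>x. indicat_real A (X x) * 1 \<partial>M) = (\<integral>x. indicat_real A (X' x) * 1 \<partial>N)"
    by (rule weighted_law_unique_nonneg[OF assms(1-4), where B=1]) (use char0 in simp_all)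
  ultimately show ?thesis
    using i by (simp add: distrib_left)
qed

text \<open>Weights are real in the uniqueness lemmas; Euler's formula reassembles the complex
  exponential from its cosine and sine weights.\<close>

lemma integral_indicator_iexp:
  fixes X Y :: "'a \<Rightarrow> real"
  assumes "prob_space K" and [measurable]: "X \<in> borel_measurable K" "Y \<in> borel_measurable K"
    "A \<in> sets borel"
  shows "(CLINT x|K. indicator A (X x) * iexp (b * Y x)) =
    of_real (\<integral>x. indicator A (X x) * cos (b * Y x) \<partial>K) + \<i> * of_real (\<integral>x. indicator A (X x) * sin
      (b * Y x) \<partial>K)"
proof -
  interpret K: prob_space K by fact
  have "integrable K (\<lambda>x. indicator A (X x) * cos (b * Y x))" "integrable K (\<lambda>x. indicator A (X x)
    * sin (b * Y x))"
    by (auto intro!: K.integrable_const_bound[of _ 1] simp: indicator_def)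
  then have "of_real (\<integral>x. indicator A (X x) * cos (b * Y x) \<partial>K) + \<i> * of_real (\<integral>x. indicator A (X
    x) * sin (b * Y x) \<partial>K)
    = (CLINT x|K. of_real (indicator A (X x) * cos (b * Y x)) + \<i> * of_real (indicator A (X x) *
      sin (b * Y x)))"
    by (subst Bochner_Integration.integral_add) (auto simp del: of_real_mult)
  also have "\<dots> = (CLINT x|K. indicator A (X x) * iexp (b * Y x))"
    by (intro Bochner_Integration.integral_cong refl) (simp add: indicator_def exp_Euler
      cos_of_real sin_of_real flip: of_real_mult)
  finally show ?thesis ..
qed

text \<open>The integrand is arranged so that \<open>V\<close> is the variable and
  \<open>indicator A (U x)\<close> the weight, as the second use of the uniqueness lemma
  requires.\<close>

lemma measure_distr_Times:
  fixes U V :: "'a \<Rightarrow> real"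
  assumes [measurable]: "U \<in> borel_measurable M" "V \<in> borel_measurable M" "A \<in> sets borel"
    "B \<in> sets borel"
  shows "measure (distr M borel (\<lambda>x. (U x, V x))) (A \<times> B) = (\<integral>x. indicator B (V x) * indicator A
    (U x) \<partial>M)"
proof -
  have "measure (distr M borel (\<lambda>x. (U x, V x))) (A \<times> B) = measure M {x\<in>space M. U x \<in> A \<and> V x \<in> B}"
    by (subst measure_distr) (auto intro!: arg_cong[where f="measure M"] simp flip: borel_prod)
  also have "\<dots> = (\<integral>x. indicator {x\<in>space M. U x \<in> A \<and> V x \<in> B} x \<partial>M)" by (simp add: Int_absorb1)
  also have "\<dots> = (\<integral>x. indicator B (V x) * indicator A (U x) \<partial>M)"
    by (intro Bochner_Integration.integral_cong) (auto simp: indicator_def)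
  finally show ?thesis .
qed

text \<open>Levy's one-dimensional uniqueness theorem is applied twice: to the law of \<open>U\<close> weighted by
  \<open>cos (b V)\<close> and \<open>sin (b V)\<close>, and then to the law of \<open>V\<close> restricted to \<open>{U \<in> A}\<close>.\<close>

lemma joint_law_unique:
  fixes U V :: "'a \<Rightarrow> real" and U' V' :: "'b \<Rightarrow> real"
  assumes "prob_space M" "prob_space N"
    and [measurable]: "U \<in> borel_measurable M" "V \<in> borel_measurable M"
      "U' \<in> borel_measurable N" "V' \<in> borel_measurable N"
    and char: "\<And>a b. (CLINT x|M. iexp (a * U x + b * V x)) = (CLINT x|N. iexp (a * U' x
      + b * V' x))"
  shows "distr M borel (\<lambda>x. (U x, V x)) = distr N borel (\<lambda>x. (U' x, V' x))"
proof -
  interpret M: prob_space M by fact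
  interpret N: prob_space N by fact
  have char1: "(CLINT x|M. iexp (a * U x)) = (CLINT x|N. iexp (a * U' x))" for a
    using char[of a 0] by simp
  have cos_eq: "complex_of_real (cos y) = (iexp y + iexp (-y)) / 2"
    and sin_eq: "complex_of_real (sin y) = (iexp y - iexp (-y)) / (2 * \<i>)" for y
    by (simp_all add: cos_exp_eq sin_exp_eq flip: cos_of_real sin_of_real)
  have int: "integrable M (\<lambda>x. iexp (a * U x + b * V x))" "integrable N (\<lambda>x. iexp (a * U' x
    + b * V' x))" for a b
    by (auto intro!: M.integrable_const_bound[of _ 1] N.integrable_const_bound[of _ 1] simp del:
      of_real_mult of_real_add)
  \<comment> \<open>The weighted characters are linear combinations of the joint characters at
    \<open>(a, b)\<close> and \<open>(a, - b)\<close>, on which both sides agree by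
    \<open>char\<close>.\<close>
  have e: "iexp (a * u) * of_real (cos (b * v)) = (iexp (a * u + b * v) + iexp (a * u
    + (- b) * v)) / 2"
    "iexp (a * u) * of_real (sin (b * v)) = (iexp (a * u + b * v) - iexp (a * u
      + (- b) * v)) / (2 * \<i>)" for a b u v :: real
    unfolding cos_eq sin_eq by (simp_all add: exp_add exp_diff exp_minus distrib_left
      right_diff_distrib divide_simps)
  have cos2: "(CLINT x|M. iexp (a * U x) * of_real (cos (b * V x)))
    = (CLINT x|N. iexp (a * U' x) * of_real (cos (b * V' x)))" for a b
    unfolding e integral_divide_zero by (simp only: Bochner_Integration.integral_add int char)
  have sin2: "(CLINT x|M. iexp (a * U x) * of_real (sin (b * V x)))
    = (CLINT x|N. iexp (a * U' x) * of_real (sin (b * V' x)))" for a b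
    unfolding e integral_divide_zero by (simp only: Bochner_Integration.integral_diff int char)
  have slice: "(CLINT x|M. indicator A (U x) * iexp (b * V x)) = (CLINT x|N. indicator A (U' x) *
    iexp (b * V' x))"
    if [measurable]: "A \<in> sets borel" for A b
  proof -
    have "(\<integral>x. indicator A (U x) * cos (b * V x) \<partial>M) = (\<integral>x. indicator A (U' x) * cos (b * V' x) \<partial>N)"
      by (rule weighted_law_unique[OF assms(1,2)])
         (simp_all only: cos2 char1, simp_all)
    moreover have "(\<integral>x. indicator A (U x) * sin (b * V x) \<partial>M) = (\<integral>x. indicator A (U' x) * sin (b *
      V' x) \<partial>N)"
      by (rule weighted_law_unique[OF assms(1,2)])
         (simp_all only: sin2 char1, simp_all)
    ultimately show ?thesis
      using integral_indicator_iexp[of M U V A b] integral_indicator_iexp[of N U' V' A b]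
        assms(1,2) by simp
  qed
  \<comment> \<open>The roles change here: \<open>V\<close> is now the variable, and the nonnegative
    weight \<open>indicator A (U x)\<close> has the characters computed in
    \<open>slice\<close>.\<close>
  have rect: "(\<integral>x. indicat_real B (V x) * indicator A (U x) \<partial>M) = (\<integral>x. indicat_real B (V' x) *
    indicator A (U' x) \<partial>N)"
    if [measurable]: "A \<in> sets borel" "B \<in> sets borel" for A B
  proof (rule weighted_law_unique_nonneg[OF assms(1,2), where B=1])
    fix t
    show "(CLINT x|M. iexp (t * V x) * of_real (indicator A (U x)))
      = (CLINT x|N. iexp (t * V' x) * of_real (indicator A (U' x)))"
      using slice[of A t] by (simp add: mult.commute of_real_indicator)
  qed (auto simp: indicator_def)
  let ?E = "{a \<times> b | a b. a \<in> sets (borel :: real measure) \<and> b \<in> sets (borel :: real measure)}"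
  show ?thesis
  proof (rule measure_eqI_generator_eq[OF Int_stable_pair_measure_generator, where \<Omega>=UNIV
    and A="\<lambda>_. UNIV"])
    show "sets (distr M borel (\<lambda>x. (U x, V x))) = sigma_sets UNIV ?E" "sets (distr N borel (\<lambda>x.
      (U' x, V' x))) = sigma_sets UNIV ?E"
      by (simp_all add: sets_pair_measure flip: borel_prod)
  next
    fix X assume "X \<in> ?E"
    then obtain A B where X: "X = A \<times> B" and [measurable]: "A \<in> sets borel" "B \<in> sets borel" by auto
    have "measure (distr M borel (\<lambda>x. (U x, V x))) X = measure (distr N borel (\<lambda>x. (U' x, V' x))) X"
      using rect by (simp add: X measure_distr_Times)
    then show "emeasure (distr M borel (\<lambda>x. (U x, V x))) X = emeasure (distr N borel (\<lambda>x. (U' x,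
      V' x))) X"
      using M.finite_measure_axioms N.finite_measure_axioms
      by (simp add: finite_measure.emeasure_eq_measure M.finite_measure_distr
        N.finite_measure_distr flip: borel_prod)
  next
    have "prob_space (distr M borel (\<lambda>x. (U x, V x)))"
      by (rule M.prob_space_distr) (simp flip: borel_prod)
    then interpret D: prob_space "distr M borel (\<lambda>x. (U x, V x))" .
    show "emeasure (distr M borel (\<lambda>x. (U x, V x))) UNIV \<noteq> \<infinity>" by simp
  next
    have "UNIV \<times> UNIV \<in> ?E" by (intro CollectI exI[of _ UNIV]) simp
    then show "range (\<lambda>_. UNIV) \<subseteq> ?E" by auto
  qed simp_all
qed

section \<open>Standardized jointly normal pairs\<close>

text \<open>Recovers the parameters, which joint normality only asserts to exist, from the first two
  moments. The point mass has no density and is treated apart.\<close>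

lemma normal_law_moments:
  assumes "prob_space M" and [measurable]: "X \<in> borel_measurable M"
    and law: "distr M borel X = normal_law \<mu> \<sigma>" and "0 \<le> \<sigma>"
  shows "prob_space.expectation M X = \<mu>" "prob_space.variance M X = \<sigma>\<^sup>2"
proof -
  interpret prob_space M by fact
  have "expectation X = \<mu> \<and> variance X = \<sigma>\<^sup>2"
  proof (cases "\<sigma> = 0")
    case True
    have i: "(\<integral>x. f (X x) \<partial>M) = f \<mu>" if [measurable]: "f \<in> borel_measurable borel"
      for f :: "real \<Rightarrow> real"
    proof -
      have "(\<integral>x. f (X x) \<partial>M) = (\<integral>x. f x \<partial>distr M borel X)"
        by (simp add: integral_distr)
      also have "\<dots> = f \<mu>"
        using True by (simp add: law normal_law_def integral_return)
      finally show ?thesis .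
    qed
    have "expectation X = \<mu>" using i[of "\<lambda>x. x"] by simp
    then show ?thesis using True i[of "\<lambda>x. (x - \<mu>)\<^sup>2"] by simp
  next
    case False
    have "distributed M lborel X (normal_density \<mu> \<sigma>)"
    proof -
      have "distr M lborel X = distr M borel X" by (rule distr_cong) auto
      then show ?thesis using False by (simp add: distributed_def law normal_law_def)
    qed
    then show ?thesis
      using False \<open>0 \<le> \<sigma>\<close> normal_distributed_expectation[of \<sigma> X \<mu>] normal_distributed_variance[of
        \<sigma> X \<mu>] by simp
  qed
  then show "expectation X = \<mu>" "variance X = \<sigma>\<^sup>2" by auto
qed

text \<open>Coefficient functions on \<open>bool\<close> correspond to pairs of reals via
  \<open>case_bool\<close>.\<close>

lemma jointly_normal_pair_iff:
  "jointly_normal M UNIV (case_bool U V) \<longleftrightarrow>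
     U \<in> borel_measurable M \<and> V \<in> borel_measurable M \<and>
     (\<forall>a b. \<exists>\<mu> \<sigma>. \<sigma> \<ge> 0 \<and> distr M borel (\<lambda>\<omega>. a * U \<omega> + b * V \<omega>) = normal_law \<mu> \<sigma>)"
proof -
  have "(\<forall>a :: bool \<Rightarrow> real. P (a True) (a False)) \<longleftrightarrow> (\<forall>a b. P a b)" for P
  proof (intro iffI allI)
    fix x y assume "\<forall>a :: bool \<Rightarrow> real. P (a True) (a False)"
    from this[rule_format, of "case_bool x y"] show "P x y" by simp
  qed blast
  from this[of "\<lambda>a b. \<exists>\<mu> \<sigma>. \<sigma> \<ge> 0 \<and> distr M borel (\<lambda>\<omega>. a * U \<omega> + b * V \<omega>) = normal_law \<mu> \<sigma>"]
  show ?thesis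
    unfolding jointly_normal_def by (auto simp: UNIV_bool add.commute split: bool.splits)
qed

text \<open>Raw moments replace variance and covariance; they agree because the means are
  zero.\<close>

definition std_normal_pair :: "'a measure \<Rightarrow> ('a \<Rightarrow> real) \<Rightarrow> ('a \<Rightarrow> real) \<Rightarrow> real \<Rightarrow> bool" where
  "std_normal_pair M U V r \<longleftrightarrow> prob_space M \<and> jointly_normal M UNIV (case_bool U V) \<and>
     integral\<^sup>L M U = 0 \<and> integral\<^sup>L M V = 0 \<and>
     (\<integral>\<omega>. (U \<omega>)\<^sup>2 \<partial>M) = 1 \<and> (\<integral>\<omega>. (V \<omega>)\<^sup>2 \<partial>M) = 1 \<and> (\<integral>\<omega>. U \<omega> * V \<omega> \<partial>M) = r"

lemma std_normal_pairD:
  assumes "std_normal_pair M U V r"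
  shows "prob_space M" "U \<in> borel_measurable M" "V \<in> borel_measurable M"
  using assms by (auto simp: std_normal_pair_def jointly_normal_pair_iff)

text \<open>The combination is normal, so its mean 0 and its variance, a quadratic form in
  \<open>a\<close> and \<open>b\<close>, determine its law.\<close>

lemma std_normal_pair_linear_law:
  assumes "std_normal_pair M U V r"
  shows "distr M borel (\<lambda>\<omega>. a * U \<omega> + b * V \<omega>) = normal_law 0 (sqrt (a\<^sup>2 + b\<^sup>2 + 2 * a * b * r))"
proof -
  note [measurable] = std_normal_pairD[OF assms]
  interpret prob_space M using std_normal_pairD[OF assms] by simp
  have m: "integral\<^sup>L M U = 0" "integral\<^sup>L M V = 0"
     "(\<integral>\<omega>. (U \<omega>)\<^sup>2 \<partial>M) = 1" "(\<integral>\<omega>. (V \<omega>)\<^sup>2 \<partial>M) = 1" "(\<integral>\<omega>. U \<omega> * V \<omega> \<partial>M) = r"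
    using assms by (auto simp: std_normal_pair_def)
  \<comment> \<open>The Bochner integral of a non-integrable function is 0 by convention, so a
    second moment equal to 1 forces integrability.\<close>
  have i2: "integrable M (\<lambda>\<omega>. (U \<omega>)\<^sup>2)" "integrable M (\<lambda>\<omega>. (V \<omega>)\<^sup>2)"
    using m not_integrable_integral_eq by fastforce+
  have i1: "integrable M U" "integrable M V"
    by (rule square_integrable_imp_integrable; use i2 in simp)+
  have iUV: "integrable M (\<lambda>\<omega>. U \<omega> * V \<omega>)"
  proof (rule Bochner_Integration.integrable_bound)
    show "integrable M (\<lambda>\<omega>. (U \<omega>)\<^sup>2 + (V \<omega>)\<^sup>2)" using i2 by simp
    have "\<bar>x * y\<bar> \<le> x\<^sup>2 + y\<^sup>2" for x y :: real
      using sum_squares_bound[of "\<bar>x\<bar>" "\<bar>y\<bar>"] mult_nonneg_nonneg[OF abs_ge_zero abs_ge_zero, of x y]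
      unfolding abs_mult power2_abs mult.assoc by linarith
    then show "AE x in M. norm (U x * V x) \<le> norm ((U x)\<^sup>2 + (V x)\<^sup>2)" by auto
  qed simp
  obtain \<mu> \<sigma> where s: "\<sigma> \<ge> 0" and law: "distr M borel (\<lambda>\<omega>. a * U \<omega> + b * V \<omega>) = normal_law \<mu> \<sigma>"
    using assms unfolding std_normal_pair_def jointly_normal_pair_iff by blast
  have e: "expectation (\<lambda>\<omega>. a * U \<omega> + b * V \<omega>) = 0"
    using i1 m by simp
  then have "\<mu> = 0"
    using normal_law_moments(1)[OF prob_space_axioms _ law s] by simp
  have "variance (\<lambda>\<omega>. a * U \<omega> + b * V \<omega>) = (\<integral>\<omega>. a\<^sup>2 * (U \<omega>)\<^sup>2 + b\<^sup>2 * (V \<omega>)\<^sup>2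
    + 2 * a * b * (U \<omega> * V \<omega>) \<partial>M)"
    unfolding e by (intro Bochner_Integration.integral_cong) (auto
      simp: power2_sum power_mult_distrib)
  also have "\<dots> = a\<^sup>2 + b\<^sup>2 + 2 * a * b * r"
    using i2 iUV m by simp
  finally have "\<sigma>\<^sup>2 = a\<^sup>2 + b\<^sup>2 + 2 * a * b * r"
    using normal_law_moments(2)[OF prob_space_axioms _ law s] by simp
  then have "\<sigma> = sqrt (a\<^sup>2 + b\<^sup>2 + 2 * a * b * r)"
    using s by (metis real_sqrt_unique)
  with law \<open>\<mu> = 0\<close> show ?thesis by simp
qed

text \<open>Cramer--Wold: the joint characteristic function at \<open>(a, b)\<close> is an integral
  against the law of \<open>a * U + b * V\<close>, which depends only on \<open>a\<close>,
  \<open>b\<close> and \<open>r\<close>.\<close>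

lemma std_normal_pair_law_unique:
  assumes 1: "std_normal_pair M U V r" and 2: "std_normal_pair N U' V' r"
  shows "distr M borel (\<lambda>x. (U x, V x)) = distr N borel (\<lambda>x. (U' x, V' x))"
proof (rule joint_law_unique)
  note [measurable] = std_normal_pairD[OF 1] std_normal_pairD[OF 2]
  fix a b
  have "(CLINT x|M. iexp (a * U x + b * V x)) = (CLINT y|distr M borel (\<lambda>\<omega>. a * U \<omega>
    + b * V \<omega>). iexp y)"
    by (subst integral_distr) auto
  also have "\<dots> = (CLINT y|distr N borel (\<lambda>\<omega>. a * U' \<omega> + b * V' \<omega>). iexp y)"
    unfolding std_normal_pair_linear_law[OF 1] std_normal_pair_linear_law[OF 2] ..
  also have "\<dots> = (CLINT x|N. iexp (a * U' x + b * V' x))"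
    by (subst integral_distr) auto
  finally show "(CLINT x|M. iexp (a * U x + b * V x)) = (CLINT x|N. iexp (a * U' x + b * V' x))" .
qed (use std_normal_pairD[OF 1] std_normal_pairD[OF 2] in auto)

lemma std_normal_pair_bivariate:
  assumes "-1 \<le> r" "r \<le> 1"
  shows "std_normal_pair (bivariate_normal_law r) fst snd r"
  using bivariate_normal_law_moments[OF assms] prob_space_bivariate_normal_law
    bivariate_normal_law_jointly_normal
  by (simp add: std_normal_pair_def covariance_def)

lemma std_normal_pair_law:
  assumes "std_normal_pair M U V r" "-1 \<le> r" "r \<le> 1"
  shows "distr M borel (\<lambda>x. (U x, V x)) = bivariate_normal_law r"
  using std_normal_pair_law_unique[OF assms(1) std_normal_pair_bivariate[OF assms(2,3)]]
  by (simp add: distr_id2 bivariate_normal_law_def)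

lemma std_normal_pair_swap:
  assumes "std_normal_pair M U V r"
  shows "std_normal_pair M V U r"
  using assms unfolding std_normal_pair_def jointly_normal_pair_iff
  by (simp add: mult.commute[of "V _"] add.commute[of "_ * V _"])

text \<open>Reflection turns lower tails into upper tails at the cost of negating the
  correlation.\<close>

lemma std_normal_pair_uminus:
  assumes "std_normal_pair M U V r"
  shows "std_normal_pair M (\<lambda>\<omega>. - U \<omega>) V (- r)"
proof -
  have "\<exists>\<mu> \<sigma>. \<sigma> \<ge> 0 \<and> distr M borel (\<lambda>\<omega>. a * - U \<omega> + b * V \<omega>) = normal_law \<mu> \<sigma>" for a b
  proof -
    obtain \<mu> \<sigma> where "\<sigma> \<ge> 0" "distr M borel (\<lambda>\<omega>. (- a) * U \<omega> + b * V \<omega>) = normal_law \<mu> \<sigma>"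
      using assms unfolding std_normal_pair_def jointly_normal_pair_iff by blast
    then show ?thesis by auto
  qed
  then show ?thesis
    using assms unfolding std_normal_pair_def jointly_normal_pair_iff by simp
qed

lemma normal_law_0_1: "normal_law 0 1 = std_normal_distribution"
  by (simp add: normal_law_def)

lemma std_normal_pair_marginals:
  assumes "std_normal_pair M U V r"
  shows "distr M borel U = std_normal_distribution" "distr M borel V = std_normal_distribution"
  using std_normal_pair_linear_law[OF assms, of 1 0] std_normal_pair_linear_law[OF assms, of 0 1]
  by (simp_all add: normal_law_0_1)

section \<open>Two-sided rejection probabilities\<close>

text \<open>Inclusion--exclusion for the complements \<open>U \<le> c\<close> and
  \<open>V \<le> c\<close>, whose probabilities come from the standard normal marginals and the
  joint law.\<close>

lemma prob_both_greater:
  assumes p: "std_normal_pair M U V r" and r: "-1 \<le> r" "r \<le> 1"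
  shows "\<P>(\<omega> in M. c < U \<omega> \<and> c < V \<omega>) = 1 - 2 * std_normal_cdf c + bivariate_normal_cdf r c c"
proof -
  note [measurable] = std_normal_pairD(2,3)[OF p]
  interpret prob_space M using std_normal_pairD(1)[OF p] .
  have U: "\<P>(\<omega> in M. U \<omega> \<le> c) = std_normal_cdf c"
    unfolding std_normal_cdf_def cdf_def std_normal_pair_marginals(1)[OF p, symmetric]
    by (subst measure_distr) (auto intro!: arg_cong[where f=prob])
  have V: "\<P>(\<omega> in M. V \<omega> \<le> c) = std_normal_cdf c"
    unfolding std_normal_cdf_def cdf_def std_normal_pair_marginals(2)[OF p, symmetric]
    by (subst measure_distr) (auto intro!: arg_cong[where f=prob])
  have UV: "\<P>(\<omega> in M. U \<omega> \<le> c \<and> V \<omega> \<le> c) = bivariate_normal_cdf r c c"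
    unfolding bivariate_normal_cdf_def std_normal_pair_law[OF p r, symmetric]
    by (subst measure_distr) (auto intro!: arg_cong[where f=prob] simp flip: borel_prod)
  have "\<P>(\<omega> in M. c < U \<omega> \<and> c < V \<omega>) = \<P>(\<omega> in M. c < U \<omega>) - \<P>(\<omega> in M. c < U \<omega> \<and> V \<omega> \<le> c)"
    by (subst finite_measure_Diff[symmetric]) (auto intro!: arg_cong[where f=prob])
  moreover have "\<P>(\<omega> in M. c < U \<omega> \<and> V \<omega> \<le> c) = \<P>(\<omega> in M. V \<omega> \<le> c) - \<P>(\<omega> in M. U \<omega> \<le> c \<and> V \<omega> \<le> c)"
    by (subst finite_measure_Diff[symmetric]) (auto intro!: arg_cong[where f=prob])
  moreover have "\<P>(\<omega> in M. c < U \<omega>) = 1 - \<P>(\<omega> in M. U \<omega> \<le> c)"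
    by (subst prob_compl[symmetric]) (auto intro!: arg_cong[where f=prob])
  ultimately show ?thesis using U V UV by simp
qed

text \<open>The event splits into four quadrants, disjoint because \<open>0 \<le> c\<close>. Equal
  signs contribute correlation \<open>r\<close>, opposite signs \<open>- r\<close>; the constants
  combine by 4 - 8 p = 4 (1 - p)^2 - 4 p^2 with p = \<open>std_normal_cdf c\<close>.\<close>

lemma prob_abs_both_greater:
  assumes p: "std_normal_pair M U V r" and r: "-1 \<le> r" "r \<le> 1" and "0 \<le> c"
  shows "\<P>(\<omega> in M. c < \<bar>U \<omega>\<bar> \<and> c < \<bar>V \<omega>\<bar>) = R_fun r c + 4 * (1 - std_normal_cdf c)\<^sup>2"
proof -
  note [measurable] = std_normal_pairD(2,3)[OF p]
  interpret prob_space M using std_normal_pairD(1)[OF p] .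
  note n = std_normal_pair_uminus[OF p]
  note s = std_normal_pair_swap
  note pp = prob_both_greater[OF p r]
  have np: "\<P>(\<omega> in M. c < - U \<omega> \<and> c < V \<omega>) = 1 - 2 * std_normal_cdf c + bivariate_normal_cdf (-r)
    c c"
    using prob_both_greater[OF n] r by simp
  \<comment> \<open>The second coordinate is negated by swapping, negating the first and swapping
    back; in \<open>nn\<close> the two sign changes cancel in the correlation.\<close>
  have pn: "\<P>(\<omega> in M. c < U \<omega> \<and> c < - V \<omega>) = 1 - 2 * std_normal_cdf c + bivariate_normal_cdf (-r)
    c c"
    using prob_both_greater[OF s[OF std_normal_pair_uminus[OF s[OF p]]]] r by simp
  have nn: "\<P>(\<omega> in M. c < - U \<omega> \<and> c < - V \<omega>) = 1 - 2 * std_normal_cdf c + bivariate_normal_cdf r c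
    c"
    using prob_both_greater[OF s[OF std_normal_pair_uminus[OF s[OF n]]]] r by simp
  have "\<P>(\<omega> in M. c < \<bar>U \<omega>\<bar> \<and> c < \<bar>V \<omega>\<bar>) =
     prob (({\<omega>\<in>space M. c < U \<omega> \<and> c < V \<omega>} \<union> {\<omega>\<in>space M. c < - U \<omega> \<and> c < V \<omega>}) \<union>
           ({\<omega>\<in>space M. c < U \<omega> \<and> c < - V \<omega>} \<union> {\<omega>\<in>space M. c < - U \<omega> \<and> c < - V \<omega>}))"
    using \<open>0 \<le> c\<close> by (intro arg_cong[where f=prob]) auto
  also have "\<dots> = \<P>(\<omega> in M. c < U \<omega> \<and> c < V \<omega>) + \<P>(\<omega> in M. c < - U \<omega> \<and> c < V \<omega>) +
      (\<P>(\<omega> in M. c < U \<omega> \<and> c < - V \<omega>) + \<P>(\<omega> in M. c < - U \<omega> \<and> c < - V \<omega>))"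
    using \<open>0 \<le> c\<close> by (subst finite_measure_Union, simp, simp, force)+ simp
  also have "\<dots> = R_fun r c + 4 * (1 - std_normal_cdf c)\<^sup>2"
    unfolding pp np pn nn R_fun_def by (simp add: power2_eq_square algebra_simps)
  finally show ?thesis .
qed

text \<open>Both \<open>fst\<close> and its negative are standard normal under a bivariate law. The
  correlation 1 is an arbitrary choice, since only a marginal is used. The point \<open>x\<close>
  that separates \<open>{x..}\<close> from the complement of \<open>{..x}\<close> is a null
  set.\<close>

lemma std_normal_cdf_uminus: "std_normal_cdf (- x) = 1 - std_normal_cdf x"
proof -
  interpret real_distribution std_normal_distribution by (rule real_dist_normal_dist)
  have "std_normal_pair (bivariate_normal_law 1) fst snd 1"
    by (rule std_normal_pair_bivariate) auto
  note p = this std_normal_pair_uminus[OF this]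
  note [measurable] = std_normal_pairD[OF p(1)]
  have "std_normal_cdf (- x) = measure (distr (bivariate_normal_law 1) borel (\<lambda>p. - fst p)) {.. -
    x}"
    unfolding std_normal_pair_marginals(1)[OF p(2)] by (simp add: std_normal_cdf_def cdf_def)
  also have "\<dots> = measure (distr (bivariate_normal_law 1) borel fst) {x..}"
    by (subst (1 2) measure_distr) (auto intro!: arg_cong[where f="measure _"])
  also have "\<dots> = measure std_normal_distribution {x..}"
    unfolding std_normal_pair_marginals(1)[OF p(1)] ..
  also have "\<dots> = measure std_normal_distribution (space std_normal_distribution - {..x})"
  proof (rule measure_eq_AE)
    have "AE y in lborel. y \<noteq> x"  by (rule AE_lborel_singleton)
    then show "AE y in std_normal_distribution. y \<in> {x..} \<longleftrightarrow> y \<in> space std_normal_distribution -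
      {..x}"
      by (subst AE_density) (auto elim!: eventually_mono)
  qed auto
  also have "\<dots> = 1 - std_normal_cdf x"
    by (subst prob_compl) (auto simp: std_normal_cdf_def cdf_def)
  finally show ?thesis .
qed

text \<open>A negative \<open>c\<close> would satisfy \<open>c < - c\<close>, and monotonicity with
  the reflection formula would bound the CDF at \<open>c\<close> by 1/2.\<close>

lemma quantile_nonneg:
  assumes "std_normal_cdf c > 1 / 2"
  shows "0 \<le> c"
proof (rule ccontr)
  interpret real_distribution std_normal_distribution by (rule real_dist_normal_dist)
  assume "\<not> 0 \<le> c"
  then have "std_normal_cdf c \<le> std_normal_cdf (- c)"
    unfolding std_normal_cdf_def cdf_def by (intro finite_measure_mono) auto
  then show False using assms unfolding std_normal_cdf_uminus by simp
qed

text \<open>The two tails are disjoint for \<open>0 \<le> c\<close> and have equal mass by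
  reflection. At the critical value this yields the level of a single test.\<close>

lemma prob_abs_greater:
  assumes "prob_space M" and [measurable]: "X \<in> borel_measurable M"
    and law: "distr M borel X = std_normal_distribution" and "0 \<le> c"
  shows "\<P>(\<omega> in M. c < \<bar>X \<omega>\<bar>) = 2 * (1 - std_normal_cdf c)"
proof -
  interpret N: real_distribution std_normal_distribution by (rule real_dist_normal_dist)
  have "\<P>(\<omega> in M. c < \<bar>X \<omega>\<bar>) = measure std_normal_distribution {x. c < \<bar>x\<bar>}"
    unfolding law[symmetric]
    by (subst measure_distr) (auto intro!: arg_cong[where f="measure _"])
  also have "\<dots> = measure std_normal_distribution {c<..} + measure std_normal_distribution {..<-c}"
    using \<open>0 \<le> c\<close> by (subst N.finite_measure_Union[symmetric]) (auto
      intro!: arg_cong[where f="measure _"])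
  also have "measure std_normal_distribution {c<..} = 1 - std_normal_cdf c"
    unfolding std_normal_cdf_def cdf_def
    by (subst N.prob_compl[symmetric]) (auto intro!: arg_cong[where f="measure _"])
  also have "measure std_normal_distribution {..<-c} = std_normal_cdf (- c)"
    unfolding std_normal_cdf_def cdf_def
  proof (rule measure_eq_AE)
    have "AE y in lborel. y \<noteq> - c"  by (rule AE_lborel_singleton)
    then show "AE y in std_normal_distribution. y \<in> {..<-c} \<longleftrightarrow> y \<in> {..-c}"
      by (subst AE_density) (auto elim!: eventually_mono)
  qed auto
  finally show ?thesis by (simp add: std_normal_cdf_uminus)
qed

section \<open>The Ornstein--Uhlenbeck kernel and monotonicity in the correlation\<close>

interpretation std_normal: real_distribution std_normal_distribution
  by (rule real_dist_normal_dist)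

interpretation std_normal_prod: pair_prob_space std_normal_distribution std_normal_distribution ..

text \<open>Mehler's formula: for 0 < r \<le> 1 this is the Ornstein--Uhlenbeck semigroup at time -
  ln r. It is also the conditional expectation of \<open>f V\<close> given \<open>U = z\<close> for
  a standard normal pair of correlation \<open>r\<close> in [-1, 1].\<close>

definition ou_kernel :: "real \<Rightarrow> (real \<Rightarrow> real) \<Rightarrow> real \<Rightarrow> real" where
  "ou_kernel r f z = (\<integral>w. f (r * z + sqrt (1 - r\<^sup>2) * w) \<partial>std_normal_distribution)"

text \<open>This class contains indicators, is preserved by products and by the kernel, and is
  integrable under every probability measure, so no L^2 space has to be set up.\<close>

definition test_fun :: "(real \<Rightarrow> real) \<Rightarrow> bool" where
  "test_fun f \<longleftrightarrow> f \<in> borel_measurable borel \<and> (\<forall>x. \<bar>f x\<bar> \<le> 1)"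

lemma test_funD:
  assumes "test_fun f"
  shows "f \<in> borel_measurable borel" "\<bar>f x\<bar> \<le> 1"
  using assms by (auto simp: test_fun_def)

lemma test_fun_mult: "test_fun f \<Longrightarrow> test_fun g \<Longrightarrow> test_fun (\<lambda>x. f x * g x)"
  by (auto simp: test_fun_def abs_mult intro!: mult_le_one)

lemma test_fun_integrable:
  assumes "prob_space M" "test_fun f" and [measurable]: "X \<in> borel_measurable M"
  shows "integrable M (\<lambda>x. f (X x))"
proof -
  interpret prob_space M by fact
  note [measurable] = test_funD(1)[OF assms(2)]
  show ?thesis
    using test_funD(2)[OF assms(2)] by (auto intro!: integrable_const_bound[of _ 1])
qed

lemma test_fun_ou_kernel:
  assumes f: "test_fun f"
  shows "test_fun (ou_kernel r f)"
  unfolding test_fun_def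
proof safe
  note [measurable] = test_funD(1)[OF f]
  show "ou_kernel r f \<in> borel_measurable borel"
    unfolding ou_kernel_def by measurable
  fix z
  have "\<bar>ou_kernel r f z\<bar> \<le> (\<integral>w. \<bar>f (r * z + sqrt (1 - r\<^sup>2) * w)\<bar> \<partial>std_normal_distribution)"
    unfolding ou_kernel_def by (rule integral_abs_bound)
  also have "\<dots> \<le> 1"
    using test_funD(2)[OF f]
    by (intro std_normal.integral_le_const integrable_abs test_fun_integrable[OF _ f]) (auto
      simp: std_normal.prob_space_axioms)
  finally show "\<bar>ou_kernel r f z\<bar> \<le> 1" .
qed

text \<open>Fubini, integrating out the independent noise first. Joint expectations thereby become
  inner products with the kernel.\<close>

lemma integral_bivariate_normal_law:
  assumes f: "test_fun f" and g: "test_fun g"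
  shows "(\<integral>p. g (fst p) * f (snd p) \<partial>bivariate_normal_law r)
    = (\<integral>z. g z * ou_kernel r f z \<partial>std_normal_distribution)"
proof -
  note [measurable] = test_funD(1)[OF f] test_funD(1)[OF g]
  have "\<bar>g x * f y\<bar> \<le> 1" for x y
    using test_funD(2)[OF f] test_funD(2)[OF g] by (auto simp: abs_mult intro!: mult_le_one)
  then have i: "integrable (std_normal_distribution \<Otimes>\<^sub>M std_normal_distribution) (\<lambda>p. g (fst p) *
    f (r * fst p + sqrt (1 - r\<^sup>2) * snd p))"
    by (auto intro!: std_normal_prod.integrable_const_bound[of _ 1])
  have "(\<integral>p. g (fst p) * f (snd p) \<partial>bivariate_normal_law r)
     = (\<integral>p. g (fst p) * f (r * fst p + sqrt (1 - r\<^sup>2) * snd p) \<partial>(std_normal_distribution \<Otimes>\<^sub>M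
       std_normal_distribution))"
    unfolding bivariate_normal_law_def by (subst integral_distr) (auto simp: case_prod_beta
      simp flip: borel_prod)
  also have "\<dots> = (\<integral>z. \<integral>w. g z * f (r * z + sqrt (1 - r\<^sup>2) * w) \<partial>std_normal_distribution
    \<partial>std_normal_distribution)"
    by (subst std_normal_prod.integral_fst'[OF i, symmetric]) simp
  also have "\<dots> = (\<integral>z. g z * ou_kernel r f z \<partial>std_normal_distribution)"
    by (simp add: ou_kernel_def)
  finally show ?thesis .
qed

text \<open>Exchanging the coordinates preserves the bivariate law, hence the kernel is
  self-adjoint.\<close>

lemma ou_kernel_symmetric:
  assumes f: "test_fun f" and g: "test_fun g" and r: "-1 \<le> r" "r \<le> 1"
  shows "(\<integral>z. g z * ou_kernel r f z \<partial>std_normal_distribution)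
    = (\<integral>z. f z * ou_kernel r g z \<partial>std_normal_distribution)"
proof -
  note [measurable] = test_funD(1)[OF f] test_funD(1)[OF g]
  note p = std_normal_pair_bivariate[OF r]
  note [measurable] = std_normal_pairD(2,3)[OF p]
  have "(\<integral>p. g (fst p) * f (snd p) \<partial>bivariate_normal_law r)
    = (\<integral>p. g (fst p) * f (snd p) \<partial>distr (bivariate_normal_law r) borel (\<lambda>p. (snd p, fst p)))"
    unfolding std_normal_pair_law[OF std_normal_pair_swap[OF p] r] ..
  also have "\<dots> = (\<integral>p. f (fst p) * g (snd p) \<partial>bivariate_normal_law r)"
    by (subst integral_distr) (auto simp: mult.commute simp flip: borel_prod)
  finally show ?thesis
    by (simp add: integral_bivariate_normal_law f g)
qed

text \<open>At correlation 0 the bivariate law is the law of the independent pair itself.\<close>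

lemma distr_linear_comb_std_normal:
  "distr (std_normal_distribution \<Otimes>\<^sub>M std_normal_distribution) borel (\<lambda>p. a * fst p + b * snd p)
    = normal_law 0 (sqrt (a\<^sup>2 + b\<^sup>2))"
proof -
  have "distr (bivariate_normal_law 0) borel (\<lambda>p. a * fst p + b * snd p) = normal_law 0 (sqrt (a\<^sup>2
    + b\<^sup>2))"
    using std_normal_pair_linear_law[OF std_normal_pair_bivariate[of 0]] by simp
  then show ?thesis
    unfolding bivariate_normal_law_def
    by (subst (asm) distr_distr) (auto simp: o_def case_prod_beta simp flip: borel_prod)
qed

text \<open>Two steps add independent noises with variances s^2 (1 - r^2) and 1 - s^2. Their sum is
  centered normal with variance 1 - (r s)^2, the noise of a single step with parameter
  \<open>r * s\<close>.\<close>

lemma ou_kernel_ou_kernel: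
  assumes f: "test_fun f" and r: "\<bar>r\<bar> \<le> 1" and s: "\<bar>s\<bar> \<le> 1"
  shows "ou_kernel r (ou_kernel s f) = ou_kernel (r * s) f"
proof
  fix z
  note [measurable] = test_funD(1)[OF f]
  define a b c where "a = s * sqrt (1 - r\<^sup>2)" and "b = sqrt (1 - s\<^sup>2)" and "c
    = sqrt (1 - (r * s)\<^sup>2)"
  have rs: "r\<^sup>2 \<le> 1" "s\<^sup>2 \<le> 1" using r s by (simp_all add: abs_square_le_1)
  then have "(r * s)\<^sup>2 \<le> 1" by (simp add: power_mult_distrib mult_le_one)
  \<comment> \<open>The summand 0 makes the single-noise integral an instance of \<open>fold\<close>
    as well, with second coefficient 0.\<close>
  then have eq: "a\<^sup>2 + b\<^sup>2 = c\<^sup>2 + 0\<^sup>2"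
    using rs by (simp add: a_def b_def c_def power_mult_distrib algebra_simps)
  have i: "integrable (std_normal_distribution \<Otimes>\<^sub>M std_normal_distribution) (\<lambda>p. f (r * s * z
    + (u * fst p + v * snd p)))" for u v
    by (rule test_fun_integrable[OF _ f]) (auto simp: std_normal_prod.prob_space_axioms)
  have fold: "(\<integral>w'. \<integral>w. f (r * s * z + (u * w' + v * w)) \<partial>std_normal_distribution
    \<partial>std_normal_distribution)
      = (\<integral>y. f (r * s * z + y) \<partial>normal_law 0 (sqrt (u\<^sup>2 + v\<^sup>2)))" for u v
    unfolding distr_linear_comb_std_normal[symmetric]
    using std_normal_prod.integral_fst'[OF i, of u v] by (subst integral_distr) simp_all
  have "ou_kernel r (ou_kernel s f) z = (\<integral>w'. \<integral>w. f (r * s * z + (a * w'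
    + b * w)) \<partial>std_normal_distribution \<partial>std_normal_distribution)"
    unfolding ou_kernel_def a_def b_def by (intro Bochner_Integration.integral_cong refl
      arg_cong[where f=f]) (simp add: algebra_simps)
  also have "\<dots> = (\<integral>w'. \<integral>w. f (r * s * z + (c * w' + 0 * w)) \<partial>std_normal_distribution
    \<partial>std_normal_distribution)"
    unfolding fold eq ..
  also have "\<dots> = ou_kernel (r * s) f z"
    using std_normal.prob_space by (simp add: ou_kernel_def c_def)
  finally show "ou_kernel r (ou_kernel s f) z = ou_kernel (r * s) f z" .
qed

text \<open>After the pointwise bound, symmetry moves the kernel onto the constant 1, which it
  fixes; this is invariance of the normal law under the kernel.\<close>

lemma ou_kernel_contraction:
  assumes f: "test_fun f" and r: "-1 \<le> r" "r \<le> 1"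
  shows "(\<integral>z. (ou_kernel r f z)\<^sup>2 \<partial>std_normal_distribution)
    \<le> (\<integral>z. (f z)\<^sup>2 \<partial>std_normal_distribution)"
proof -
  note P = std_normal.prob_space_axioms
  have f2: "test_fun (\<lambda>x. (f x)\<^sup>2)" using test_fun_mult[OF f f] by (simp add: power2_eq_square)
  have k2: "test_fun (\<lambda>x. (ou_kernel r f x)\<^sup>2)"
    using test_fun_mult[OF test_fun_ou_kernel test_fun_ou_kernel, OF f f]
      by (simp add: power2_eq_square)
  have one: "test_fun (\<lambda>_. 1)" by (simp add: test_fun_def)
  \<comment> \<open>nonnegativity of the conditional variance\<close>
  have "(ou_kernel r f z)\<^sup>2 \<le> ou_kernel r (\<lambda>x. (f x)\<^sup>2) z" for z
  proof -
    have "integrable std_normal_distribution (\<lambda>w. f (r * z + sqrt (1 - r\<^sup>2) * w))"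
      "integrable std_normal_distribution (\<lambda>w. (f (r * z + sqrt (1 - r\<^sup>2) * w))\<^sup>2)"
      by (auto intro!: test_fun_integrable[OF P f] test_fun_integrable[OF P f2])
    from std_normal.variance_eq[OF this] std_normal.variance_positive[of "\<lambda>w. f (r * z
      + sqrt (1 - r\<^sup>2) * w)"]
    show ?thesis by (simp add: ou_kernel_def)
  qed
  then have "(\<integral>z. (ou_kernel r f z)\<^sup>2 \<partial>std_normal_distribution) \<le> (\<integral>z. 1 * ou_kernel r (\<lambda>x. (f
    x)\<^sup>2) z \<partial>std_normal_distribution)"
    using test_fun_integrable[OF P k2, of "\<lambda>x. x"] test_fun_integrable[OF P test_fun_ou_kernel[OF
      f2], of "\<lambda>x. x" r]
    by (intro integral_mono) auto
  also have "\<dots> = (\<integral>z. (f z)\<^sup>2 * ou_kernel r (\<lambda>_. 1) z \<partial>std_normal_distribution)"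
    by (rule ou_kernel_symmetric[OF f2 one r])
  also have "\<dots> = (\<integral>z. (f z)\<^sup>2 \<partial>std_normal_distribution)"
    using std_normal.prob_space by (simp add: ou_kernel_def)
  finally show ?thesis .
qed

lemma bivariate_normal_law_square_mono:
  assumes [measurable]: "A \<in> sets borel" and rs: "0 \<le> r" "r \<le> s" "s \<le> 1"
  shows "measure (bivariate_normal_law r) (A \<times> A) \<le> measure (bivariate_normal_law s) (A \<times> A)"
proof (cases "s = 0")
  \<comment> \<open>Here \<open>r = s = 0\<close>; otherwise the quotient \<open>r / s\<close> used
    below has a nonzero denominator.\<close>
  case True
  then show ?thesis using rs by simp
next
  case False
  have f: "test_fun (indicator A)" by (auto simp: test_fun_def indicator_def)
  \<comment> \<open>Half of the kernel goes to each factor. This needs \<open>0 \<le> t\<close> for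
    the square root and the same set \<open>A\<close> in both coordinates.\<close>
  have sq: "measure (bivariate_normal_law t) (A \<times> A) = (\<integral>z. (ou_kernel (sqrt t) (indicator A) z)\<^sup>2
    \<partial>std_normal_distribution)"
    if t: "0 \<le> t" "t \<le> 1" for t
  proof -
    note p = std_normal_pairD(2,3)[OF std_normal_pair_bivariate[of t]]
    have "measure (bivariate_normal_law t) (A \<times> A) = measure (distr (bivariate_normal_law t) borel
      (\<lambda>p. (fst p, snd p))) (A \<times> A)"
      using std_normal_pair_law[OF std_normal_pair_bivariate] t by simp
    also have "\<dots> = (\<integral>p. indicator A (fst p) * indicator A (snd p) \<partial>bivariate_normal_law t)"
      using p t by (subst measure_distr_Times) (auto simp: mult.commute)
    also have "\<dots> = (\<integral>z. indicator A z * ou_kernel (sqrt t) (ou_kernel (sqrt t) (indicator A)) z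
      \<partial>std_normal_distribution)"
      using f t by (simp add: integral_bivariate_normal_law ou_kernel_ou_kernel)
    also have "\<dots> = (\<integral>z. (ou_kernel (sqrt t) (indicator A) z)\<^sup>2 \<partial>std_normal_distribution)"
      unfolding power2_eq_square
      by (rule ou_kernel_symmetric) (use f t in \<open>auto intro: test_fun_ou_kernel order_trans[OF _
        real_sqrt_ge_zero]\<close>)
    finally show ?thesis .
  qed
  have u: "0 \<le> sqrt (r / s)" "sqrt (r / s) \<le> 1"
    using rs False by auto
  have "sqrt (r / s) * sqrt s = sqrt r"
    using False by (simp flip: real_sqrt_mult)
  then have "ou_kernel (sqrt r) (indicator A) = ou_kernel (sqrt (r / s)) (ou_kernel (sqrt s)
    (indicator A))"
    using f u rs by (subst ou_kernel_ou_kernel) auto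
  then show ?thesis
    using ou_kernel_contraction[OF test_fun_ou_kernel[OF f], of "sqrt (r / s)" "sqrt s"] u rs
    by (simp add: sq)
qed

section \<open>The variance of the error count\<close>

text \<open>The coefficients are a sum of two indicators, which also covers \<open>i = j\<close>;
  that case later supplies the marginals.\<close>

lemma jointly_normal_pair:
  assumes X: "jointly_normal M I X" and "finite I" and i: "i \<in> I" and j: "j \<in> I"
  shows "jointly_normal M UNIV (case_bool (X i) (X j))"
  unfolding jointly_normal_pair_iff
proof (intro conjI allI)
  show "X i \<in> borel_measurable M" "X j \<in> borel_measurable M"
    using X i j by (auto simp: jointly_normal_def)
  fix a b :: real
  have "(\<Sum>k\<in>I. ((if k = i then a else 0) + (if k = j then b else 0)) * X k \<omega>) = a * X i \<omega>
    + b * X j \<omega>" for \<omega>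
    using \<open>finite I\<close> i j by (simp add: distrib_right sum.distrib if_distrib[of "\<lambda>x. x * _"] cong:
      if_cong)
  moreover have "\<exists>\<mu> \<sigma>. \<sigma> \<ge> 0 \<and> distr M borel
      (\<lambda>\<omega>. \<Sum>k\<in>I. ((if k = i then a else 0) + (if k = j then b else 0)) * X k \<omega>) = normal_law \<mu> \<sigma>"
    using X[unfolded jointly_normal_def, THEN conjunct2, THEN spec] .
  ultimately show "\<exists>\<mu> \<sigma>. \<sigma> \<ge> 0 \<and> distr M borel (\<lambda>\<omega>. a * X i \<omega> + b * X j \<omega>) = normal_law \<mu> \<sigma>"
    by simp
qed

lemma std_normal_pairI:
  assumes "prob_space M" "jointly_normal M UNIV (case_bool U V)"
    and "integral\<^sup>L M U = 0" "integral\<^sup>L M V = 0"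
    and "prob_space.variance M U = 1" "prob_space.variance M V = 1" "covariance M U V = r"
  shows "std_normal_pair M U V r"
  using assms by (simp add: std_normal_pair_def covariance_def)

text \<open>Both sides are masses of a square \<open>A \<times> A\<close> under bivariate normal
  laws, with the same tail set \<open>A\<close>.\<close>

lemma prob_abs_both_greater_mono:
  assumes "std_normal_pair M U V r" "std_normal_pair N U' V' s" and rs: "0 \<le> r" "r \<le> s" "s \<le> 1"
  shows "\<P>(\<omega> in M. c < \<bar>U \<omega>\<bar> \<and> c < \<bar>V \<omega>\<bar>) \<le> \<P>(\<omega> in N. c < \<bar>U' \<omega>\<bar> \<and> c < \<bar>V' \<omega>\<bar>)"
proof -
  have *: "\<P>(\<omega> in K. c < \<bar>X \<omega>\<bar> \<and> c < \<bar>Y \<omega>\<bar>) = measure (bivariate_normal_law t) ({x. c < \<bar>x\<bar>} \<times> {x.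
    c < \<bar>x\<bar>})"
    if p: "std_normal_pair K X Y t" and t: "0 \<le> t" "t \<le> 1" for K :: "'c measure" and X Y t
  proof -
    note [measurable] = std_normal_pairD(2,3)[OF p]
    have "distr K borel (\<lambda>x. (X x, Y x)) = bivariate_normal_law t"
      by (rule std_normal_pair_law[OF p]) (use t in auto)
    then show ?thesis
      by (subst \<open>_ = bivariate_normal_law t\<close>[symmetric], subst measure_distr)
        (auto intro!: arg_cong[where f="measure _"] simp flip: borel_prod)
  qed
  show ?thesis
    using rs by (simp add: *[OF assms(1)] *[OF assms(2)] bivariate_normal_law_square_mono)
qed

text \<open>The second moment is the double sum of joint rejection probabilities: \<alpha> on the
  diagonal, at most \<beta> + \<alpha>^2 off it. Subtracting the squared mean (C \<alpha>)^2 leaves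
  the bound; normality does not enter.\<close>

lemma variance_error_count_le:
  fixes T :: "nat \<Rightarrow> 'a \<Rightarrow> real"
  assumes "prob_space M" and [measurable]: "\<And>i. i \<in> {1..C} \<Longrightarrow> T i \<in> borel_measurable M"
    and single: "\<And>i. i \<in> {1..C} \<Longrightarrow> \<P>(\<omega> in M. c < \<bar>T i \<omega>\<bar>) = \<alpha>"
    and pair: "\<And>i j. i \<in> {1..C} \<Longrightarrow> j \<in> {1..C} \<Longrightarrow> i \<noteq> j \<Longrightarrow>
      \<P>(\<omega> in M. c < \<bar>T i \<omega>\<bar> \<and> c < \<bar>T j \<omega>\<bar>) \<le> \<beta> + \<alpha>\<^sup>2"
  shows "prob_space.variance M (error_count M T c C) \<le> real C * \<alpha> * (1 - \<alpha>)
    + real C * (real C - 1) * \<beta>"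
proof -
  interpret prob_space M by fact
  define R where "R = rejection_event M T c"
  have R[measurable]: "R i \<in> sets M" if "i \<in> {1..C}" for i
    using that unfolding R_def rejection_event_def by measurable
  have ind: "integrable M (indicat_real (R i \<inter> R j))" "expectation (indicat_real (R i \<inter> R j))
    = prob (R i \<inter> R j)"
    if "i \<in> {1..C}" "j \<in> {1..C}" for i j
    using R[OF that(1)] R[OF that(2)]
    by (auto simp: emeasure_eq_measure Int_absorb2 sets.sets_into_space)
  have count: "error_count M T c C = (\<lambda>\<omega>. \<Sum>i=1..C. indicator (R i) \<omega>)"
    by (simp add: fun_eq_iff error_count_def R_def)
  have sq: "(error_count M T c C \<omega>)\<^sup>2 = (\<Sum>i=1..C. \<Sum>j=1..C. indicator (R i \<inter> R j) \<omega>)" for \<omega>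
    unfolding count power2_eq_square sum_product by (simp add: indicator_inter_arith)
  have int: "integrable M (error_count M T c C)" "integrable M (\<lambda>\<omega>. (error_count M T c C \<omega>)\<^sup>2)"
    unfolding sq unfolding count using R
    by (auto intro!: Bochner_Integration.integrable_sum integrable_real_indicator
      simp: emeasure_eq_measure)
  have "expectation (error_count M T c C) = (\<Sum>i=1..C. prob (R i))"
    unfolding count using R by (subst Bochner_Integration.integral_sum) (auto
      simp: emeasure_eq_measure Int_absorb2 sets.sets_into_space)
  also have "\<dots> = real C * \<alpha>"
    using single by (simp add: R_def rejection_event_def)
  finally have 1: "expectation (error_count M T c C) = real C * \<alpha>" .
  have "expectation (\<lambda>\<omega>. (error_count M T c C \<omega>)\<^sup>2) = (\<Sum>i=1..C. \<Sum>j=1..C. prob (R i \<inter> R j))"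
    unfolding sq
  proof (subst Bochner_Integration.integral_sum)
    show "(\<Sum>i=1..C. expectation (\<lambda>\<omega>. \<Sum>j=1..C. indicator (R i \<inter> R j) \<omega>))
      = (\<Sum>i=1..C. \<Sum>j=1..C. prob (R i \<inter> R j))"
      using ind by (intro sum.cong refl) (subst Bochner_Integration.integral_sum, auto)
  qed (use ind in auto)
  \<comment> \<open>The off-diagonal bound is charged to every pair, and the \<open>if\<close> term
    corrects the diagonal to \<alpha>.\<close>
  also have "\<dots> \<le> (\<Sum>i=1..C. \<Sum>j=1..C. (\<beta> + \<alpha>\<^sup>2) + (if j = i then \<alpha> - (\<beta> + \<alpha>\<^sup>2) else 0))"
  proof (intro sum_mono)
    fix i j assume ij: "i \<in> {1..C}" "j \<in> {1..C}"
    have "R i \<inter> R j = {\<omega>\<in>space M. c < \<bar>T i \<omega>\<bar> \<and> c < \<bar>T j \<omega>\<bar>}"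
      by (auto simp: R_def rejection_event_def)
    then show "prob (R i \<inter> R j) \<le> (\<beta> + \<alpha>\<^sup>2) + (if j = i then \<alpha> - (\<beta> + \<alpha>\<^sup>2) else 0)"
      using pair[OF ij] single[OF ij(1)] by (cases "i = j") auto
  qed
  also have "\<dots> = real C * (real C * (\<beta> + \<alpha>\<^sup>2) + (\<alpha> - (\<beta> + \<alpha>\<^sup>2)))"
    by (simp add: sum.distrib distrib_left)
  finally show ?thesis
    using variance_eq[OF int] 1 by (simp add: power2_eq_square algebra_simps)
qed

theorem corollary2:
  fixes M :: "'a measure" and T :: "nat \<Rightarrow> 'a \<Rightarrow> real" and \<rho> :: "nat \<Rightarrow> nat \<Rightarrow> real"
    and \<alpha> c \<rho>\<^sub>0 :: real and C :: nat
  assumes alpha: "0 < \<alpha>" "\<alpha> < 1"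
    and c: "std_normal_cdf c = 1 - \<alpha> / 2"
    and rho0: "0 \<le> \<rho>\<^sub>0" "\<rho>\<^sub>0 \<le> 1"
    and M: "prob_space M"
    and normal: "jointly_normal M {1..C} T"
    and mean: "\<And>i. i \<in> {1..C} \<Longrightarrow> prob_space.expectation M (T i) = 0"
    and var: "\<And>i. i \<in> {1..C} \<Longrightarrow> prob_space.variance M (T i) = 1"
    and cov: "\<And>i j. i \<in> {1..C} \<Longrightarrow> j \<in> {1..C} \<Longrightarrow> covariance M (T i) (T j) = \<rho> i j"
    and rho: "\<And>i j. i \<in> {1..C} \<Longrightarrow> j \<in> {1..C} \<Longrightarrow> i \<noteq> j \<Longrightarrow> 0 \<le> \<rho> i j \<and> \<rho> i j \<le> \<rho>\<^sub>0"
  shows "prob_space.variance M (error_count M T c C)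
           \<le> real C * \<alpha> * (1 - \<alpha>) + real C * (real C - 1) * R_fun \<rho>\<^sub>0 c
       \<and> (\<forall>(N :: 'b measure) U V r.
            prob_space N \<longrightarrow> -1 \<le> r \<longrightarrow> r \<le> 1 \<longrightarrow>
            jointly_normal N UNIV (case_bool U V) \<longrightarrow>
            prob_space.expectation N U = 0 \<longrightarrow> prob_space.expectation N V = 0 \<longrightarrow>
            prob_space.variance N U = 1 \<longrightarrow> prob_space.variance N V = 1 \<longrightarrow>
            covariance N U V = r \<longrightarrow>
            R_fun r c = \<P>(\<omega> in N. \<bar>U \<omega>\<bar> > c \<and> \<bar>V \<omega>\<bar> > c) - \<alpha>\<^sup>2)"
proof -
  note p = std_normal_pairI[OF M jointly_normal_pair[OF normal finite_atLeastAtMost] mean mean var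
    var cov]
  \<comment> \<open>Since \<alpha> < 1, the CDF at \<open>c\<close> exceeds 1/2.\<close>
  have c0: "0 \<le> c" using c alpha by (intro quantile_nonneg) simp
  have a2: "4 * (1 - std_normal_cdf c)\<^sup>2 = \<alpha>\<^sup>2"
    unfolding c by (simp add: power2_eq_square)
  have R: "R_fun r c = \<P>(\<omega> in K. \<bar>U \<omega>\<bar> > c \<and> \<bar>V \<omega>\<bar> > c) - \<alpha>\<^sup>2"
    if "std_normal_pair K U V r" "-1 \<le> r" "r \<le> 1" for K :: "'c measure" and U V r
    using prob_abs_both_greater[OF that c0] a2 by simp
  \<comment> \<open>The comparison pair, with the largest admissible correlation.\<close>
  have b: "std_normal_pair (bivariate_normal_law \<rho>\<^sub>0) fst snd \<rho>\<^sub>0"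
    using rho0 by (intro std_normal_pair_bivariate) auto
  have "prob_space.variance M (error_count M T c C) \<le> real C * \<alpha> * (1 - \<alpha>) + real C * (real C - 1)
    * R_fun \<rho>\<^sub>0 c"
  proof (rule variance_error_count_le[OF M])
    fix i assume i: "i \<in> {1..C}"
    \<comment> \<open>The degenerate pair \<open>(T i, T i)\<close> gives measurability and the
      standard normal marginal of \<open>T i\<close>.\<close>
    note pi = p[OF i i i i i i i i]
    show "T i \<in> borel_measurable M" using std_normal_pairD[OF pi] by simp
    then show "\<P>(\<omega> in M. c < \<bar>T i \<omega>\<bar>) = \<alpha>"
      using prob_abs_greater[OF M _ std_normal_pair_marginals(1)[OF pi] c0] c by simp
    fix j assume j: "j \<in> {1..C}" and "i \<noteq> j"
    then have "0 \<le> \<rho> i j" "\<rho> i j \<le> \<rho>\<^sub>0" using rho[OF i j] by auto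
    \<comment> \<open>Monotonicity raises the correlation to \<open>\<rho>\<^sub>0\<close>, where
      \<open>R\<close> evaluates the probability.\<close>
    then show "\<P>(\<omega> in M. c < \<bar>T i \<omega>\<bar> \<and> c < \<bar>T j \<omega>\<bar>) \<le> R_fun \<rho>\<^sub>0 c + \<alpha>\<^sup>2"
      using prob_abs_both_greater_mono[OF p[OF i j i j i j i j] b] R[OF b] rho0 by simp
  qed
  then show ?thesis
    using R std_normal_pairI by blast
qed

end
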